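(* Let $n\ge 1$ be an integer, $Q=2n+2\ge 4$, $\alpha>Q$ and $p_\alpha=\frac{2Q}{Q+\alpha}$. Then there exists a sharp (i.e. largest possible) constant $N_{Q,\alpha,\mathbb{H}}$ such that for all nonnegative functions $F,G\in L^{p_\alpha}(\mathbb{H}^n)$, $$\int_{\mathbb{H}^n}\int_{\mathbb{H}^n} \frac{F(u)G(v)}{|v^{-1}u|^{Q-\alpha}}\,du\,dv\;\geq\; N_{Q,\alpha,\mathbb{H}}\,\|F\|_{L^{p_\alpha}(\mathbb{H}^n)}\,\|G\|_{L^{p_\alpha}(\mathbb{H}^n)}.$$ The sharp constant satisfies $$N_{Q,\alpha,\mathbb{H}}\geq \frac{(8|B_1|)^{(Q-\alpha)/Q}}{2p_\alpha^2},$$ where $B_1=\{u\in\mathbb{H}^n: |u|<1\}$ and its volume is $$|B_1|=\int_{|u|<1}du=\frac{2\pi^{\frac{Q-2}{2}}\,\Gamma(\frac12)\,\Gamma(\frac{Q+2}{4})}{(Q-2)\,\Gamma(\frac{Q-2}{2})\,\Gamma(\frac{Q+4}{4})}.$$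
   Context: The Heisenberg group $\mathbb{H}^n$ is the set $\mathbb{C}^n\times\mathbb{R}=\{(z,t): z=(z_1,\dots,z_n)\in\mathbb{C}^n,\ t\in\mathbb{R}\}$ with multiplication $(z,t)(z',t')=(z+z',\,t+t'+2\,\mathrm{Im}(z\cdot\overline{z'}))$, where $z\cdot\overline{z'}=\sum_{j=1}^n z_j\overline{z_j'}$; write $z_j=x_j+\sqrt{-1}\,y_j$. For $u=(z,t)$ the norm is $|u|=(|z|^4+t^2)^{1/4}$, and the distance between $u,v\in\mathbb{H}^n$ is $|v^{-1}u|$. The Haar measure is Lebesgue measure $du=dx\,dy\,dt$, and $|\Omega|$ is the Haar measure of a set $\Omega$. $Q=2n+2$ is the homogeneous dimension. For $0<p<1$, $L^p(\mathbb{H}^n)$ is the set of measurable functions $F$ with $\|F\|_{L^p(\mathbb{H}^n)}=\left(\int_{\mathbb{H}^n}|F|^p\,du\right)^{1/p}<\infty$ (a quasi-norm); since $\alpha>Q$ we have $p_\alpha\in(0,1)$. The double integral of nonnegative functions takes values in $[0,+\infty]$. *)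

theory Defs
  imports "HOL-Analysis.Analysis"
begin

text \<open>The Heisenberg group of \<open>n = CARD('n)\<close> complex dimensions; its Haar measure is
  \<^const>\<open>lebesgue\<close> on the underlying Euclidean space.\<close>

type_synonym 'n heis = "(complex ^ 'n) \<times> real"

definition heis_dim :: "'n::finite itself \<Rightarrow> real" where
  "heis_dim _ = 2 * real CARD('n) + 2"

definition hermitian :: "complex ^ 'n \<Rightarrow> complex ^ 'n \<Rightarrow> complex" where
  "hermitian z w = (\<Sum>j\<in>UNIV. z $ j * cnj (w $ j))"

definition heis_mult :: "'n::finite heis \<Rightarrow> 'n heis \<Rightarrow> 'n heis" where
  "heis_mult u v = (fst u + fst v, snd u + snd v + 2 * Im (hermitian (fst u) (fst v)))"

definition heis_inv :: "'n::finite heis \<Rightarrow> 'n heis" where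
  "heis_inv u = (- fst u, - snd u)"

lemma heis_mult_zero: "heis_mult 0 u = u" "heis_mult u 0 = u"
  by (simp_all add: heis_mult_def hermitian_def prod_eq_iff)

lemma heis_mult_inv: "heis_mult (heis_inv u) u = 0" "heis_mult u (heis_inv u) = 0"
  by (simp_all add: heis_mult_def heis_inv_def hermitian_def prod_eq_iff)

lemma heis_mult_assoc: "heis_mult (heis_mult u v) w = heis_mult u (heis_mult v w)"
  by (simp add: heis_mult_def hermitian_def prod_eq_iff algebra_simps sum.distrib)

definition heis_norm :: "'n::finite heis \<Rightarrow> real" where
  "heis_norm u = root 4 (norm (fst u) ^ 4 + (snd u)\<^sup>2)"

definition heis_dist :: "'n::finite heis \<Rightarrow> 'n heis \<Rightarrow> real" where
  "heis_dist u v = heis_norm (heis_mult (heis_inv v) u)"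

definition heis_unit_ball :: "'n::finite heis set" where
  "heis_unit_ball = {u. heis_norm u < 1}"

definition Lp_space :: "real \<Rightarrow> ('n::finite heis \<Rightarrow> real) set" where
  "Lp_space p = {F \<in> borel_measurable lebesgue. integrable lebesgue (\<lambda>u. \<bar>F u\<bar> powr p)}"

definition Lp_norm :: "real \<Rightarrow> ('n::finite heis \<Rightarrow> real) \<Rightarrow> real" where
  "Lp_norm p F = (LINT u|lebesgue. \<bar>F u\<bar> powr p) powr (1 / p)"

text \<open>The integrand vanishes on the diagonal \<open>u = v\<close>: there \<open>0 powr (Q - \<alpha>) = 0\<close> and division by
  zero gives zero, which is the value of \<open>|v\<^sup>-\<^sup>1 u|\<close> to the power \<open>\<alpha> - Q > 0\<close>.\<close>

definition HLS_integral :: "real \<Rightarrow> ('n::finite heis \<Rightarrow> real) \<Rightarrow> ('n heis \<Rightarrow> real) \<Rightarrow> ennreal" where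
  "HLS_integral \<alpha> F G =
     (\<integral>\<^sup>+ v. (\<integral>\<^sup>+ u. ennreal (F u * G v / heis_dist u v powr (heis_dim TYPE('n) - \<alpha>))
        \<partial>lebesgue) \<partial>lebesgue)"

definition reversed_HLS :: "'n::finite itself \<Rightarrow> real \<Rightarrow> real \<Rightarrow> real \<Rightarrow> bool" where
  "reversed_HLS _ \<alpha> p C \<longleftrightarrow>
     (\<forall>F G :: 'n heis \<Rightarrow> real.
        F \<in> Lp_space p \<longrightarrow> G \<in> Lp_space p \<longrightarrow> (\<forall>u. 0 \<le> F u) \<longrightarrow> (\<forall>v. 0 \<le> G v) \<longrightarrow>
        HLS_integral \<alpha> F G \<ge> ennreal (C * Lp_norm p F * Lp_norm p G))"

end

theory Submission
  imports Defs
begin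

text \<open>
  The inequality rests on a volume bound: a ball of radius \<open>r\<close> has volume at most \<open>\<kappa> r\<^sup>Q\<close>, with
  \<open>\<kappa> = |B\<^sub>1|\<close>.  Write \<open>l = \<alpha> - Q > 0\<close> and normalise \<open>\<integral> F\<^sup>p = \<integral> G\<^sup>p = 1\<close>, which homogeneity permits.
  For every \<open>r \<ge> 0\<close>, with an Iverson bracket,
  \<open>d(u,v)\<^sup>l \<ge> r\<^sup>l - r\<^sup>l [d(u,v) < r]\<close>.
  This is applied on every pair of layers \<open>0 \<le> a \<le> F u\<close>, \<open>0 \<le> b \<le> G v\<close>, with a radius that depends
  on the levels only, \<open>r\<^sup>Q = (a b)\<^sup>-\<^sup>p\<^sup>/\<^sup>2 / (8 \<kappa>)\<close>.  The exponent \<open>-p/2\<close> is forced: it makes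
  \<open>r\<^sup>l = W (a b)\<^sup>p\<^sup>-\<^sup>1\<close> with \<open>W = (8 \<kappa>)\<close> to the power \<open>-l/Q\<close>, so that integrating \<open>r\<^sup>l\<close> over the
  layers gives \<open>W F\<^sup>p G\<^sup>p / p\<^sup>2\<close>, which integrates to the main term \<open>W / p\<^sup>2\<close>.

  The loss term lives on pairs \<open>d(u,v) < r\<close>.  It is split according to which level is smaller.  Where
  \<open>b \<le> a\<close>, the restriction \<open>b \<le> G v\<close> is dropped; the \<open>v\<close>-integral is then at most the volume of a ball
  and contributes \<open>r\<^sup>l \<kappa> r\<^sup>Q = W (a b)\<^sup>p\<^sup>/\<^sup>2\<^sup>-\<^sup>1 / 8\<close>.  Integrating over \<open>b \<le> a \<le> F u\<close> and over \<open>u\<close> gives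
  \<open>W / (4 p\<^sup>2)\<close> (lemma \<open>nn_integral_near_le\<close>), and the half \<open>a \<le> b\<close> is symmetric.  What remains is
  \<open>W / p\<^sup>2 - W / (2 p\<^sup>2) = W / (2 p\<^sup>2)\<close>, the asserted constant (lemma \<open>reversed_HLS_normalized\<close>).

  For the Heisenberg group, the volume of a ball follows by slicing.  A left translation acts on each
  \<open>t\<close>-fibre as a translation, which reduces the ball to \<open>|z - z\<^sub>0|\<^sup>4 + t\<^sup>2 < r\<^sup>4\<close>; its slices at fixed
  \<open>t\<close> are Euclidean balls, and a Beta integral remains (lemma \<open>emeasure_heis_ball\<close>).  Finally, the
  admissible constants are bounded above, as a test with the indicator of a compact set shows, and
  their supremum is admissible, so the sharp constant exists.
\<close>

section \<open>Layer integrals\<close>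

lemma nn_integral_powr_Icc:
  fixes e x :: real
  assumes "e > -1" "x \<ge> 0"
  shows "(\<integral>\<^sup>+a. ennreal (a powr e) * indicator {0..x} a \<partial>lborel) = ennreal (x powr (e + 1) / (e + 1))"
  using assms by (intro nn_integral_has_integral_lebesgue' has_integral_powr_from_0) auto

text \<open>For the indicators of layers, whose endpoints are themselves functions to be integrated over.\<close>

lemma measurable_mem_Icc [measurable (raw)]:
  fixes f g h :: "'a \<Rightarrow> real"
  assumes [measurable]: "f \<in> borel_measurable M" "g \<in> borel_measurable M" "h \<in> borel_measurable M"
  shows "Measurable.pred M (\<lambda>x. f x \<in> {g x..h x})"
  by simp

lemma measurable_mem_lessThan [measurable (raw)]:
  fixes f h :: "'a \<Rightarrow> real"
  assumes [measurable]: "f \<in> borel_measurable M" "h \<in> borel_measurable M"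
  shows "Measurable.pred M (\<lambda>x. f x \<in> {..<h x})"
  by simp

section \<open>The reversed inequality on spaces with upper regular balls\<close>

locale upper_regular_distance = sigma_finite_measure M for M :: "'a measure" +
  fixes d :: "'a \<Rightarrow> 'a \<Rightarrow> real" and \<kappa> Q l :: real
  assumes measurable_d [measurable]: "case_prod d \<in> borel_measurable (M \<Otimes>\<^sub>M M)"
    and d_commute: "d u v = d v u"
    and \<kappa>_pos: "0 < \<kappa>" and Q_pos: "0 < Q" and l_pos: "0 < l"
    and ball_le: "\<lbrakk>u \<in> space M; 0 < r\<rbrakk> \<Longrightarrow> emeasure M {v \<in> space M. d u v < r} \<le> ennreal (\<kappa> * r powr Q)"
begin

definition p :: real where
  "p = 2 * Q / (2 * Q + l)"

text \<open>Up to the factor \<open>1 / (2 p\<^sup>2)\<close>, the constant of the inequality.\<close>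

definition W :: real where
  "W = (8 * \<kappa>) powr (- l / Q)"

text \<open>
  The truncation radius for the levels \<open>a\<close> and \<open>b\<close>.  A general factor \<open>c\<close> in place of \<open>1/8\<close> gives the
  constant \<open>(c / \<kappa>)\<^sup>l\<^sup>/\<^sup>Q (1 - 4 c) / p\<^sup>2\<close>; \<open>c = 1/8\<close> makes this \<open>W / (2 p\<^sup>2)\<close>.
\<close>

definition \<rho> :: "real \<Rightarrow> real \<Rightarrow> real" where
  "\<rho> a b = ((a * b) powr (- p / 2) / (8 * \<kappa>)) powr (1 / Q)"

text \<open>The value \<open>\<rho>\<^sup>l\<close> of the kernel at distance \<open>\<rho>\<close> (see \<open>\<rho>_powr\<close>), in a form that separates \<open>a\<close> and \<open>b\<close>.\<close>

definition \<theta> :: "real \<Rightarrow> real \<Rightarrow> real" where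
  "\<theta> a b = W * (a * b) powr (p - 1)"

lemma p_bounds: "0 < p" "p < 1"
  using l_pos Q_pos by (auto simp: p_def)

lemma \<rho>_powr: "\<rho> a b powr l = \<theta> a b"
proof -
  have e: "(- p / 2) * (l / Q) = p - 1"
    using l_pos Q_pos by (simp add: p_def field_simps)
  have "\<rho> a b powr l = (a * b) powr ((- p / 2) * (l / Q)) / (8 * \<kappa>) powr (l / Q)"
    using \<kappa>_pos by (simp add: \<rho>_def powr_powr powr_divide)
  then show ?thesis
    unfolding e by (simp add: \<theta>_def W_def powr_minus field_simps)
qed

text \<open>
  The volume of the ball of radius \<open>\<rho>\<close> lowers the exponent of \<open>a b\<close> from \<open>p - 1\<close> to \<open>p/2 - 1\<close> only.
  This is still above \<open>-1\<close>, so the loss is integrable at small levels.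
\<close>

lemma ball_weight: "\<theta> a b * (\<kappa> * \<rho> a b powr Q) = W / 8 * (a * b) powr (p / 2 - 1)"
proof -
  have "\<rho> a b powr Q = (a * b) powr (- p / 2) / (8 * \<kappa>)"
    using \<kappa>_pos Q_pos by (simp add: \<rho>_def powr_powr)
  moreover have "(a * b) powr (p / 2 - 1) = (a * b) powr (p - 1) * (a * b) powr (- p / 2)"
    by (simp flip: powr_add)
  ultimately show ?thesis
    using \<kappa>_pos by (simp add: \<theta>_def)
qed

lemma W_pos: "W > 0"
  using \<kappa>_pos by (simp add: W_def)

lemma \<theta>_nonneg: "\<theta> a b \<ge> 0"
  using W_pos by (simp add: \<theta>_def)

lemma measurable_\<rho> [measurable]: "case_prod \<rho> \<in> borel_measurable (borel \<Otimes>\<^sub>M borel)"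
  unfolding \<rho>_def by measurable

lemma measurable_\<theta> [measurable]: "case_prod \<theta> \<in> borel_measurable (borel \<Otimes>\<^sub>M borel)"
  unfolding \<theta>_def by measurable

lemma ball_weight_le:
  assumes "u \<in> space M"
  shows "(\<integral>\<^sup>+v. ennreal (\<theta> a b) * indicator {..<\<rho> a b} (d u v) \<partial>M)
           \<le> ennreal (W / 8 * (a * b) powr (p / 2 - 1))"
  \<comment> \<open>The radius vanishes only at level zero, where the weight vanishes as well.\<close>
proof (cases "\<rho> a b = 0")
  case True
  then have "\<theta> a b = 0"
    using \<rho>_powr[of a b] by simp
  then show ?thesis by simp
next
  case False
  have [measurable]: "u \<in> space M" by fact
  have "\<rho> a b > 0" using False by (simp add: \<rho>_def)
  have "(\<integral>\<^sup>+v. ennreal (\<theta> a b) * indicator {..<\<rho> a b} (d u v) \<partial>M)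
      = ennreal (\<theta> a b) * (\<integral>\<^sup>+v. indicator {v \<in> space M. d u v < \<rho> a b} v \<partial>M)"
    by (subst nn_integral_cmult[symmetric]) (auto intro!: nn_integral_cong simp: indicator_def)
  also have "\<dots> = ennreal (\<theta> a b) * emeasure M {v \<in> space M. d u v < \<rho> a b}"
    by (subst nn_integral_indicator) auto
  also have "\<dots> \<le> ennreal (\<theta> a b) * ennreal (\<kappa> * \<rho> a b powr Q)"
    using ball_le[OF assms \<open>\<rho> a b > 0\<close>] by (rule mult_left_mono) simp
  finally show ?thesis
    using \<theta>_nonneg[of a b] \<kappa>_pos by (simp add: ball_weight flip: ennreal_mult)
qed

text \<open>
  Half of the loss: the layers \<open>b \<le> a \<le> F u\<close> for which \<open>v\<close> is too close to \<open>u\<close>.  The other function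
  does not occur, so that \<open>v\<close> ranges over a full ball.
\<close>

definition near :: "('a \<Rightarrow> real) \<Rightarrow> 'a \<Rightarrow> 'a \<Rightarrow> ennreal" where
  "near F u v = (\<integral>\<^sup>+a. \<integral>\<^sup>+b. indicator {0..F u} a * (indicator {0..a} b *
      (ennreal (\<theta> a b) * indicator {..<\<rho> a b} (d u v))) \<partial>lborel \<partial>lborel)"

lemma measurable_near [measurable]:
  assumes [measurable]: "F \<in> borel_measurable M"
  shows "case_prod (near F) \<in> borel_measurable (M \<Otimes>\<^sub>M M)"
  unfolding near_def by measurable

text \<open>
  By Tonelli the \<open>v\<close>-integral comes first and is the volume of a ball; the integral over \<open>b \<le> a\<close> then
  turns \<open>(a b)\<^sup>p\<^sup>/\<^sup>2\<^sup>-\<^sup>1\<close> into \<open>(2/p) a\<^sup>p\<^sup>-\<^sup>1\<close>, and the integral over \<open>a \<le> F u\<close> turns this into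
  \<open>(2/p\<^sup>2) F\<^sup>p\<close>.
\<close>

lemma nn_integral_near_le:
  assumes [measurable]: "F \<in> borel_measurable M" and F: "\<And>u. F u \<ge> 0"
  shows "(\<integral>\<^sup>+u. \<integral>\<^sup>+v. near F u v \<partial>M \<partial>M) \<le> ennreal (W / (4 * p\<^sup>2)) * (\<integral>\<^sup>+u. ennreal (F u powr p) \<partial>M)"
proof -
  interpret P: pair_sigma_finite lborel M
    by (simp add: pair_sigma_finite_def lborel.sigma_finite_measure_axioms sigma_finite_measure_axioms)
  have "(\<integral>\<^sup>+v. near F u v \<partial>M) \<le> ennreal (W / (4 * p\<^sup>2)) * ennreal (F u powr p)"
    if [measurable]: "u \<in> space M" for u
  proof -
    have inner: "(\<integral>\<^sup>+b. indicator {0..a} b * ennreal (W / 8 * (a * b) powr (p / 2 - 1)) \<partial>lborel)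
        = ennreal (W / (4 * p) * a powr (p - 1))" if "a \<ge> 0" for a
    proof -
      have "(\<integral>\<^sup>+b. indicator {0..a} b * ennreal (W / 8 * (a * b) powr (p / 2 - 1)) \<partial>lborel)
        = (\<integral>\<^sup>+b. ennreal (W / 8 * a powr (p / 2 - 1)) * (ennreal (b powr (p / 2 - 1)) * indicator {0..a} b) \<partial>lborel)"
        using that W_pos
        by (intro nn_integral_cong) (auto simp: indicator_def powr_mult simp flip: ennreal_mult)
      also have "\<dots> = ennreal (W / 8 * a powr (p / 2 - 1)) * ennreal (a powr (p / 2) / (p / 2))"
        using that p_bounds by (simp add: nn_integral_cmult nn_integral_powr_Icc)
      also have "\<dots> = ennreal (W / (4 * p) * (a powr (p / 2 - 1) * a powr (p / 2)))"
        using that p_bounds W_pos by (simp flip: ennreal_mult add: field_simps)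
      finally show ?thesis
        by (simp flip: powr_add)
    qed
    have "(\<integral>\<^sup>+v. near F u v \<partial>M)
      = (\<integral>\<^sup>+a. \<integral>\<^sup>+v. \<integral>\<^sup>+b. indicator {0..F u} a * (indicator {0..a} b *
      (ennreal (\<theta> a b) * indicator {..<\<rho> a b} (d u v))) \<partial>lborel \<partial>M \<partial>lborel)"
      unfolding near_def by (rule P.Fubini') measurable
    also have "\<dots> = (\<integral>\<^sup>+a. \<integral>\<^sup>+b. \<integral>\<^sup>+v. indicator {0..F u} a * (indicator {0..a} b *
      (ennreal (\<theta> a b) * indicator {..<\<rho> a b} (d u v))) \<partial>M \<partial>lborel \<partial>lborel)"
      by (intro nn_integral_cong P.Fubini') measurable
    also have "\<dots> = (\<integral>\<^sup>+a. \<integral>\<^sup>+b. indicator {0..F u} a * (indicator {0..a} b *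
      (\<integral>\<^sup>+v. ennreal (\<theta> a b) * indicator {..<\<rho> a b} (d u v) \<partial>M)) \<partial>lborel \<partial>lborel)"
      by (simp add: nn_integral_cmult)
    also have "\<dots> \<le> (\<integral>\<^sup>+a. \<integral>\<^sup>+b. indicator {0..F u} a * (indicator {0..a} b *
      ennreal (W / 8 * (a * b) powr (p / 2 - 1))) \<partial>lborel \<partial>lborel)"
      using that by (intro nn_integral_mono mult_left_mono ball_weight_le) auto
    also have "\<dots> = (\<integral>\<^sup>+a. indicator {0..F u} a * ennreal (W / (4 * p) * a powr (p - 1)) \<partial>lborel)"
      by (intro nn_integral_cong, subst nn_integral_cmult)
         (simp_all add: inner split: split_indicator del: times_divide_eq_left)
    also have "\<dots> = (\<integral>\<^sup>+a. ennreal (W / (4 * p)) * (ennreal (a powr (p - 1)) * indicator {0..F u} a) \<partial>lborel)"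
      using W_pos p_bounds by (intro nn_integral_cong) (auto simp: indicator_def simp flip: ennreal_mult)
    also have "\<dots> = ennreal (W / (4 * p)) * ennreal (F u powr p / p)"
      using F p_bounds by (simp add: nn_integral_cmult nn_integral_powr_Icc)
    also have "\<dots> = ennreal (W / (4 * p\<^sup>2)) * ennreal (F u powr p)"
      using W_pos p_bounds by (simp flip: ennreal_mult add: field_simps power2_eq_square)
    finally show ?thesis .
  qed
  then have "(\<integral>\<^sup>+u. \<integral>\<^sup>+v. near F u v \<partial>M \<partial>M) \<le> (\<integral>\<^sup>+u. ennreal (W / (4 * p\<^sup>2)) * ennreal (F u powr p) \<partial>M)"
    by (intro nn_integral_mono)
  then show ?thesis
    by (simp add: nn_integral_cmult)
qed

text \<open>
  On the layers \<open>a \<le> F u\<close>, \<open>b \<le> G v\<close> the weight \<open>\<theta> a b\<close> is at most the kernel when \<open>d u v \<ge> \<rho> a b\<close>;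
  otherwise it is paid for by one of the two losses, according to the smaller level.
\<close>

lemma layer_cake_bound:
  assumes F: "F u \<ge> 0" and G: "G v \<ge> 0" and u[measurable]: "u \<in> space M" and v[measurable]: "v \<in> space M"
  shows "ennreal (W / p\<^sup>2) * (ennreal (F u powr p) * ennreal (G v powr p))
     \<le> ennreal (F u * G v * d u v powr l) + (near F u v + near G v u)"
proof -
  have \<theta>_comm: "\<theta> a b = \<theta> b a" and \<rho>_comm: "\<rho> a b = \<rho> b a" for a b
    by (simp_all add: \<theta>_def \<rho>_def mult.commute)
  have [measurable]: "(\<lambda>x. d u v) \<in> borel_measurable N" for N :: "'c measure"
    by simp
  have near_swap: "near G v u = (\<integral>\<^sup>+a. \<integral>\<^sup>+b. indicator {0..G v} b * (indicator {0..b} a *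
      (ennreal (\<theta> a b) * indicator {..<\<rho> a b} (d u v))) \<partial>lborel \<partial>lborel)"
    unfolding near_def by (subst lborel_pair.Fubini') (simp_all add: \<theta>_comm \<rho>_comm d_commute)
  have "ennreal (W / p\<^sup>2) * (ennreal (F u powr p) * ennreal (G v powr p))
      = ennreal W * (ennreal (F u powr p / p) * ennreal (G v powr p / p))"
    using W_pos p_bounds by (simp flip: ennreal_mult add: field_simps power2_eq_square)
  also have "\<dots> = (\<integral>\<^sup>+a. ennreal W * (ennreal (a powr (p - 1)) * indicator {0..F u} a) *
       (\<integral>\<^sup>+b. ennreal (b powr (p - 1)) * indicator {0..G v} b \<partial>lborel) \<partial>lborel)"
    using nn_integral_powr_Icc[of "p - 1" "F u"] nn_integral_powr_Icc[of "p - 1" "G v"] F G p_bounds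
    by (subst nn_integral_multc, measurable, subst nn_integral_cmult) (simp_all add: mult.assoc)
  also have "\<dots> = (\<integral>\<^sup>+a. \<integral>\<^sup>+b. ennreal (\<theta> a b) * (indicator {0..F u} a * indicator {0..G v} b) \<partial>lborel \<partial>lborel)"
    using W_pos
    by (subst nn_integral_cmult[symmetric])
       (auto intro!: nn_integral_cong simp: \<theta>_def powr_mult ennreal_mult mult.assoc split: split_indicator)
  also have "\<dots> \<le> (\<integral>\<^sup>+a. \<integral>\<^sup>+b.
       ennreal (d u v powr l) * (indicator {0..F u} a * indicator {0..G v} b)
      + (indicator {0..F u} a * (indicator {0..a} b *
      (ennreal (\<theta> a b) * indicator {..<\<rho> a b} (d u v)))
       + indicator {0..G v} b * (indicator {0..b} a *
      (ennreal (\<theta> a b) * indicator {..<\<rho> a b} (d u v)))) \<partial>lborel \<partial>lborel)"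
  proof (intro nn_integral_mono)
    fix a b
    have "\<theta> a b \<le> d u v powr l" if "\<rho> a b \<le> d u v"
      unfolding \<rho>_powr[symmetric] using that l_pos by (intro powr_mono2) (auto simp: \<rho>_def)
    then show "ennreal (\<theta> a b) * (indicator {0..F u} a * indicator {0..G v} b)
      \<le> ennreal (d u v powr l) * (indicator {0..F u} a * indicator {0..G v} b)
      + (indicator {0..F u} a * (indicator {0..a} b *
      (ennreal (\<theta> a b) * indicator {..<\<rho> a b} (d u v)))
       + indicator {0..G v} b * (indicator {0..b} a *
      (ennreal (\<theta> a b) * indicator {..<\<rho> a b} (d u v))))"
      by (cases "\<rho> a b \<le> d u v") (auto simp: indicator_def ennreal_leI add_increasing)
  qed
  also have "\<dots> = (\<integral>\<^sup>+a. \<integral>\<^sup>+b. ennreal (d u v powr l) * (indicator {0..F u} a * indicator {0..G v} b) \<partial>lborel \<partial>lborel)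
      + (near F u v + near G v u)"
    unfolding near_swap near_def[of F] by (simp add: nn_integral_add)
  also have "(\<integral>\<^sup>+a. \<integral>\<^sup>+b. ennreal (d u v powr l) * (indicator {0..F u} a * indicator {0..G v} b) \<partial>lborel \<partial>lborel)
     = ennreal (F u * G v * d u v powr l)"
    using F G by (simp add: nn_integral_cmult nn_integral_multc ennreal_mult mult_ac)
  finally show ?thesis .
qed

text \<open>The main term is \<open>W / p\<^sup>2\<close>, and the two losses together cost at most half of it.\<close>

lemma reversed_HLS_normalized:
  assumes [measurable]: "F \<in> borel_measurable M" "G \<in> borel_measurable M"
    and F: "\<And>u. F u \<ge> 0" and G: "\<And>u. G u \<ge> 0"
    and nF: "(\<integral>\<^sup>+u. ennreal (F u powr p) \<partial>M) = 1"
    and nG: "(\<integral>\<^sup>+u. ennreal (G u powr p) \<partial>M) = 1"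
  shows "ennreal (W / (2 * p\<^sup>2)) \<le> (\<integral>\<^sup>+v. \<integral>\<^sup>+u. ennreal (F u * G v * d u v powr l) \<partial>M \<partial>M)"
   (is "_ \<le> ?J")
proof -
  interpret P: pair_sigma_finite M M
    by (simp add: pair_sigma_finite_def sigma_finite_measure_axioms)
  have "ennreal (W / p\<^sup>2) = (\<integral>\<^sup>+v. \<integral>\<^sup>+u. ennreal (W / p\<^sup>2) * (ennreal (F u powr p) * ennreal (G v powr p)) \<partial>M \<partial>M)"
    by (simp add: nn_integral_cmult nn_integral_multc nF nG)
  also have "\<dots> \<le> (\<integral>\<^sup>+v. \<integral>\<^sup>+u. ennreal (F u * G v * d u v powr l) + (near F u v + near G v u) \<partial>M \<partial>M)"
    using F G by (intro nn_integral_mono layer_cake_bound) auto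
  also have "\<dots> = (\<integral>\<^sup>+v. (\<integral>\<^sup>+u. ennreal (F u * G v * d u v powr l) \<partial>M)
      + ((\<integral>\<^sup>+u. near F u v \<partial>M) + (\<integral>\<^sup>+u. near G v u \<partial>M)) \<partial>M)"
  proof (intro nn_integral_cong)
    fix v assume [measurable]: "v \<in> space M"
    show "(\<integral>\<^sup>+u. ennreal (F u * G v * d u v powr l) + (near F u v + near G v u) \<partial>M)
      = (\<integral>\<^sup>+u. ennreal (F u * G v * d u v powr l) \<partial>M) + ((\<integral>\<^sup>+u. near F u v \<partial>M) + (\<integral>\<^sup>+u. near G v u \<partial>M))"
      by (subst nn_integral_add, measurable)+
  qed
  also have "\<dots> = ?J + ((\<integral>\<^sup>+v. \<integral>\<^sup>+u. near F u v \<partial>M \<partial>M) + (\<integral>\<^sup>+v. \<integral>\<^sup>+u. near G v u \<partial>M \<partial>M))"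
    by (subst nn_integral_add, measurable)+
  also have "(\<integral>\<^sup>+v. \<integral>\<^sup>+u. near F u v \<partial>M \<partial>M) = (\<integral>\<^sup>+u. \<integral>\<^sup>+v. near F u v \<partial>M \<partial>M)"
    by (rule P.Fubini') measurable
  also have "?J + ((\<integral>\<^sup>+u. \<integral>\<^sup>+v. near F u v \<partial>M \<partial>M) + (\<integral>\<^sup>+v. \<integral>\<^sup>+u. near G v u \<partial>M \<partial>M))
     \<le> ?J + (ennreal (W / (4 * p\<^sup>2)) + ennreal (W / (4 * p\<^sup>2)))"
    using nn_integral_near_le[of F] nn_integral_near_le[of G] F G
    by (intro add_mono) (simp_all add: nF nG)
  also have "ennreal (W / (4 * p\<^sup>2)) + ennreal (W / (4 * p\<^sup>2)) = ennreal (W / (2 * p\<^sup>2))"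
    using W_pos by (simp flip: ennreal_plus)
  finally have "ennreal (W / (2 * p\<^sup>2)) + ennreal (W / (2 * p\<^sup>2)) \<le> ?J + ennreal (W / (2 * p\<^sup>2))"
    using W_pos by (simp flip: ennreal_plus)
  then show ?thesis by (simp add: ennreal_add_left_cancel_le add.commute)
qed

lemma reversed_HLS_bound:
  assumes F: "\<And>u. F u \<ge> 0" and G: "\<And>u. G u \<ge> 0"
    and [measurable]: "F \<in> borel_measurable M" "G \<in> borel_measurable M"
    and iF: "integrable M (\<lambda>u. F u powr p)" and iG: "integrable M (\<lambda>u. G u powr p)"
  shows "ennreal (W / (2 * p\<^sup>2) * (LINT u|M. F u powr p) powr (1 / p) * (LINT u|M. G u powr p) powr (1 / p))
      \<le> (\<integral>\<^sup>+v. \<integral>\<^sup>+u. ennreal (F u * G v * d u v powr l) \<partial>M \<partial>M)"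
proof -
  define A where "A = (LINT u|M. F u powr p) powr (1 / p)"
  define B where "B = (LINT u|M. G u powr p) powr (1 / p)"
  show ?thesis
  proof (cases "A = 0 \<or> B = 0")
    case True
    then show ?thesis
      unfolding A_def[symmetric] B_def[symmetric] by auto
  next
    case False
    then have A: "A > 0" and B: "B > 0" by (auto simp: A_def B_def)
    have norm: "(\<integral>\<^sup>+u. ennreal ((H u / C) powr p) \<partial>M) = 1"
      if H: "\<And>u. H u \<ge> 0" and iH: "integrable M (\<lambda>u. H u powr p)"
        and C: "C > 0" "C = (LINT u|M. H u powr p) powr (1 / p)" for H C
    proof -
      have "(LINT u|M. H u powr p) \<ge> 0"
        by simp
      then have Cp: "C powr p = (LINT u|M. H u powr p)"
        using p_bounds C by (simp add: powr_powr)
      have "C powr p > 0"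
        using C by simp
      have "(\<integral>\<^sup>+u. ennreal ((H u / C) powr p) \<partial>M) = ennreal (LINT u|M. (H u / C) powr p)"
        using H C iH by (intro nn_integral_eq_integral) (auto simp: powr_divide)
      also have "(LINT u|M. (H u / C) powr p) = 1"
        using H \<open>C powr p > 0\<close> Cp by (simp add: powr_divide)
      finally show ?thesis by simp
    qed
    have "ennreal (W / (2 * p\<^sup>2)) \<le> (\<integral>\<^sup>+v. \<integral>\<^sup>+u. ennreal (F u / A * (G v / B) * d u v powr l) \<partial>M \<partial>M)"
      using F G A B
      by (intro reversed_HLS_normalized norm[OF F iF A A_def] norm[OF G iG B B_def]) auto
    then have "ennreal (A * B) * ennreal (W / (2 * p\<^sup>2))
      \<le> ennreal (A * B) * (\<integral>\<^sup>+v. \<integral>\<^sup>+u. ennreal (F u / A * (G v / B) * d u v powr l) \<partial>M \<partial>M)"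
      by (rule mult_left_mono) simp
    also have "\<dots> = (\<integral>\<^sup>+v. \<integral>\<^sup>+u. ennreal (A * B) * ennreal (F u / A * (G v / B) * d u v powr l) \<partial>M \<partial>M)"
      by (subst nn_integral_cmult[symmetric], measurable)
         (intro nn_integral_cong nn_integral_cmult[symmetric], measurable)
    also have "\<dots> = (\<integral>\<^sup>+v. \<integral>\<^sup>+u. ennreal (F u * G v * d u v powr l) \<partial>M \<partial>M)"
      using A B F G by (intro nn_integral_cong) (simp flip: ennreal_mult)
    also have "ennreal (A * B) * ennreal (W / (2 * p\<^sup>2)) = ennreal (W / (2 * p\<^sup>2) * A * B)"
      using A B W_pos by (simp flip: ennreal_mult add: mult_ac)
    finally show ?thesis
      by (simp add: A_def B_def)
  qed
qed

end

section \<open>Heisenberg distance\<close>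

lemma heis_norm_nonneg: "0 \<le> heis_norm u"
  by (simp add: heis_norm_def)

lemma heis_norm_less_iff:
  assumes "r > 0"
  shows "heis_norm u < r \<longleftrightarrow> norm (fst u) ^ 4 + (snd u)\<^sup>2 < r ^ 4"
proof -
  have "heis_norm u < r \<longleftrightarrow> root 4 (norm (fst u) ^ 4 + (snd u)\<^sup>2) < root 4 (r ^ 4)"
    using assms by (simp add: heis_norm_def real_root_power_cancel)
  then show ?thesis by simp
qed

lemma hermitian_commute: "hermitian w z = cnj (hermitian z w)"
  by (simp add: hermitian_def mult.commute)

lemma heis_dist_eq:
  "heis_dist u v = root 4 (norm (fst u - fst v) ^ 4 + (snd u - snd v - 2 * Im (hermitian (fst v) (fst u)))\<^sup>2)"
proof -
  have "hermitian (- fst v) (fst u) = - hermitian (fst v) (fst u)"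
    by (simp add: hermitian_def sum_negf)
  then show ?thesis
    by (simp add: heis_dist_def heis_norm_def heis_mult_def heis_inv_def)
qed

lemma heis_dist_commute: "heis_dist u v = heis_dist v u"
proof -
  have "Im (hermitian (fst v) (fst u)) = - Im (hermitian (fst u) (fst v))"
    by (subst hermitian_commute) simp
  then have "(snd u - snd v - 2 * Im (hermitian (fst v) (fst u)))\<^sup>2
     = (snd v - snd u - 2 * Im (hermitian (fst u) (fst v)))\<^sup>2"
    by (simp add: power2_eq_square algebra_simps)
  then show ?thesis
    by (simp add: heis_dist_eq norm_minus_commute)
qed

lemma continuous_on_heis_dist: "continuous_on A (\<lambda>x. heis_dist (fst x) (snd x))"
  unfolding heis_dist_eq hermitian_def
  by (intro continuous_intros)

lemma borel_measurable_heis_dist [measurable]: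
  "case_prod (heis_dist :: 'n::finite heis \<Rightarrow> _) \<in> borel_measurable (lebesgue \<Otimes>\<^sub>M lebesgue)"
proof -
  have "(\<lambda>x :: 'n heis \<times> 'n heis. heis_dist (fst x) (snd x)) \<in> borel_measurable borel"
    by (intro borel_measurable_continuous_onI continuous_on_heis_dist)
  then have 1: "case_prod (heis_dist :: 'n heis \<Rightarrow> _) \<in> borel_measurable (borel \<Otimes>\<^sub>M borel)"
    by (simp add: case_prod_beta' borel_prod)
  have [measurable]: "(\<lambda>x. x) \<in> lebesgue \<rightarrow>\<^sub>M (borel :: 'n heis measure)"
    by (simp add: measurable_completion)
  have "(\<lambda>x. (fst x, snd x)) \<in> lebesgue \<Otimes>\<^sub>M lebesgue \<rightarrow>\<^sub>M (borel :: 'n heis measure) \<Otimes>\<^sub>M (borel :: 'n heis measure)"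
    by measurable
  from measurable_compose[OF this 1] show ?thesis
    by (simp add: case_prod_beta')
qed

lemma sigma_finite_lebesgue: "sigma_finite_measure (lebesgue :: 'a::euclidean_space measure)"
proof
  obtain A where "countable A" "A \<subseteq> sets (lborel :: 'a measure)" "\<Union>A = space lborel"
      "\<forall>a\<in>A. emeasure lborel a \<noteq> \<infinity>"
    using lborel.sigma_finite_countable by blast
  then show "\<exists>A. countable A \<and> A \<subseteq> sets (lebesgue :: 'a measure) \<and> \<Union> A = space lebesgue \<and> (\<forall>a\<in>A. emeasure lebesgue a \<noteq> \<infinity>)"
    by (intro exI[of _ A]) (auto simp: subset_iff)
qed

section \<open>Volume of Heisenberg balls\<close>

text \<open>
  The volume \<open>|B\<^sub>1|\<close>, as the volume of the Euclidean unit ball of \<open>\<complex>\<^sup>n\<close> times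
  \<open>\<integral> (1 - t\<^sup>2)\<^sup>n\<^sup>/\<^sup>2 dt\<close> over \<open>[-1, 1]\<close>.
\<close>

definition heis_ball_vol :: "'n::finite itself \<Rightarrow> real" where
  "heis_ball_vol _ = unit_ball_vol (2 * real CARD('n)) * Beta (1 / 2) (real CARD('n) / 2 + 1)"

lemma heis_ball_borel: "{v. heis_dist u v < r} \<in> sets borel"
proof -
  have "continuous_on UNIV (\<lambda>v. heis_dist u v)"
    unfolding heis_dist_eq hermitian_def by (intro continuous_intros)
  then show ?thesis
    by (intro borel_open open_Collect_less) (auto intro: continuous_intros)
qed

text \<open>At \<open>|t| = r\<^sup>2\<close> the slice is empty and the right-hand side vanishes, so the interval may be closed.\<close>

lemma heis_section_ball:
  fixes z0 :: "complex ^ 'n::finite"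
  assumes "r > 0"
  shows "emeasure lborel {z. norm (z - z0) ^ 4 + t\<^sup>2 < r ^ 4}
    = indicator {- r\<^sup>2..r\<^sup>2} t * ennreal (unit_ball_vol (2 * real CARD('n)) * sqrt (r ^ 4 - t\<^sup>2) ^ CARD('n))"
proof (cases "t\<^sup>2 < r ^ 4")
  case True
  define s where "s = root 4 (r ^ 4 - t\<^sup>2)"
  have s: "s > 0" "s ^ 4 = r ^ 4 - t\<^sup>2"
    using True by (simp_all add: s_def)
  have "\<bar>t\<bar> < r\<^sup>2"
    using True power_less_imp_less_base[of "\<bar>t\<bar>" 2 "r\<^sup>2"] by simp
  then have t: "t \<in> {- r\<^sup>2..r\<^sup>2}"
    unfolding atLeastAtMost_iff by linarith
  have "s\<^sup>2 = sqrt (s ^ 4)"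
    by (intro real_sqrt_unique[symmetric]) simp_all
  then have sn: "s ^ (2 * CARD('n)) = sqrt (r ^ 4 - t\<^sup>2) ^ CARD('n)"
    unfolding s(2) power_mult by (rule arg_cong)
  have "norm (z - z0) ^ 4 + t\<^sup>2 < r ^ 4 \<longleftrightarrow> z \<in> ball z0 s" for z
  proof -
    have "norm (z - z0) ^ 4 + t\<^sup>2 < r ^ 4 \<longleftrightarrow> norm (z - z0) ^ 4 < s ^ 4"
      unfolding s(2) by linarith
    also have "\<dots> \<longleftrightarrow> norm (z - z0) < s"
      using power_less_imp_less_base[of "norm (z - z0)" 4 s] power_strict_mono[of "norm (z - z0)" s 4] s(1)
      by (metis less_imp_le norm_ge_zero zero_less_numeral)
    finally show ?thesis
      by (simp add: dist_norm norm_minus_commute)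
  qed
  then have "{z. norm (z - z0) ^ 4 + t\<^sup>2 < r ^ 4} = ball z0 s"
    by blast
  moreover have "emeasure lborel (ball z0 s) = ennreal (unit_ball_vol (2 * real CARD('n)) * s ^ (2 * CARD('n)))"
    using s(1) emeasure_ball[of s z0] by (simp add: mult.commute)
  ultimately show ?thesis
    using t unfolding sn by simp
next
  case False
  have "{z. norm (z - z0) ^ 4 + t\<^sup>2 < r ^ 4} = {}"
    using False by (simp add: not_less add_increasing)
  moreover have "t\<^sup>2 = r ^ 4" if "t \<in> {- r\<^sup>2..r\<^sup>2}"
  proof -
    have "\<bar>t\<bar> ^ 2 \<le> (r\<^sup>2)\<^sup>2" using that by (intro power_mono) auto
    then show ?thesis using False by simp
  qed
  ultimately show ?thesis
    by (auto simp: indicator_def)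
qed

text \<open>
  The fibre of the ball over \<open>z\<close> is an interval whose centre depends on \<open>z\<close> but whose length depends
  only on \<open>|z - z\<^sub>0|\<close>.  Translating each fibre to \<open>0\<close> removes the group twist, and the other order of
  integration and the substitution \<open>t = r\<^sup>2 s\<close> give the power of \<open>r\<close> and the Beta integral.
\<close>

lemma emeasure_heis_ball:
  fixes u :: "'n::finite heis"
  assumes r: "r > 0"
  shows "emeasure lborel {v. heis_dist u v < r} = ennreal (heis_ball_vol TYPE('n) * r ^ (2 * CARD('n) + 2))"
proof -
  obtain z0 t0 where u: "u = (z0, t0)" by (cases u)
  define V where "V = unit_ball_vol (2 * real CARD('n))"
  define X where "X = {v. heis_dist u v < r}"
  have V: "V \<ge> 0" by (simp add: V_def)
  have X [measurable]: "X \<in> sets (borel \<Otimes>\<^sub>M borel)"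
    unfolding X_def borel_prod by (rule heis_ball_borel)
  have X_iff: "(z, t0 - 2 * Im (hermitian z z0) + t) \<in> X \<longleftrightarrow> norm (z - z0) ^ 4 + t\<^sup>2 < r ^ 4" for z t
  proof -
    have "heis_dist u (z, t0 - 2 * Im (hermitian z z0) + t) = heis_norm (z - z0, t)"
      by (simp add: u heis_dist_eq heis_norm_def norm_minus_commute)
    then show ?thesis
      by (simp add: X_def heis_norm_less_iff r)
  qed
  have "emeasure lborel X = emeasure (lborel \<Otimes>\<^sub>M lborel) X"
    by (simp add: lborel_prod)
  also have "\<dots> = (\<integral>\<^sup>+x. indicator X x \<partial>(lborel \<Otimes>\<^sub>M lborel))"
    using X by (intro nn_integral_indicator[symmetric]) simp
  also have "\<dots> = (\<integral>\<^sup>+z. \<integral>\<^sup>+t. indicator X (z, t) \<partial>lborel \<partial>lborel)"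
    by (rule lborel.nn_integral_fst[symmetric]) measurable
  also have "\<dots> = (\<integral>\<^sup>+z. \<integral>\<^sup>+t. indicator X (z, t0 - 2 * Im (hermitian z z0) + 1 * t) \<partial>lborel \<partial>lborel)"
  proof (rule nn_integral_cong)
    fix z
    show "(\<integral>\<^sup>+t. indicator X (z, t) \<partial>lborel) = (\<integral>\<^sup>+t. indicator X (z, t0 - 2 * Im (hermitian z z0) + 1 * t) \<partial>lborel)"
      using nn_integral_real_affine[of "\<lambda>t. indicator X (z, t)" 1 "t0 - 2 * Im (hermitian z z0)"] by simp
  qed
  also have "\<dots> = (\<integral>\<^sup>+z. \<integral>\<^sup>+t. indicator {(z, t). norm (z - z0) ^ 4 + t\<^sup>2 < r ^ 4} (z, t) \<partial>lborel \<partial>lborel)"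
    by (intro nn_integral_cong) (simp add: X_iff indicator_def)
  also have "\<dots> = (\<integral>\<^sup>+t. \<integral>\<^sup>+z. indicator {(z, t). norm (z - z0) ^ 4 + t\<^sup>2 < r ^ 4} (z, t) \<partial>lborel \<partial>lborel)"
    by (rule lborel_pair.Fubini'[symmetric]) (simp add: case_prod_beta')
  also have "\<dots> = (\<integral>\<^sup>+t. emeasure lborel {z. norm (z - z0) ^ 4 + t\<^sup>2 < r ^ 4} \<partial>lborel)"
  proof (rule nn_integral_cong)
    fix t
    have "(\<integral>\<^sup>+z. indicator {(z, t). norm (z - z0) ^ 4 + t\<^sup>2 < r ^ 4} (z, t) \<partial>lborel)
      = (\<integral>\<^sup>+z. indicator {z. norm (z - z0) ^ 4 + t\<^sup>2 < r ^ 4} z \<partial>lborel)"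
      by (simp add: indicator_def)
    also have "\<dots> = emeasure lborel {z. norm (z - z0) ^ 4 + t\<^sup>2 < r ^ 4}"
      by (intro nn_integral_indicator) simp
    finally show "(\<integral>\<^sup>+z. indicator {(z, t). norm (z - z0) ^ 4 + t\<^sup>2 < r ^ 4} (z, t) \<partial>lborel)
      = emeasure lborel {z. norm (z - z0) ^ 4 + t\<^sup>2 < r ^ 4}" .
  qed
  also have "\<dots> = (\<integral>\<^sup>+t. indicator {- r\<^sup>2..r\<^sup>2} t * ennreal (V * sqrt (r ^ 4 - t\<^sup>2) ^ CARD('n)) \<partial>lborel)"
    by (simp add: heis_section_ball r V_def)
  also have "\<dots> = ennreal (r\<^sup>2) * (\<integral>\<^sup>+t. indicator {- r\<^sup>2..r\<^sup>2} (0 + r\<^sup>2 * t)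
       * ennreal (V * sqrt (r ^ 4 - (0 + r\<^sup>2 * t)\<^sup>2) ^ CARD('n)) \<partial>lborel)"
    using r by (subst nn_integral_real_affine[where c = "r\<^sup>2" and t = 0]) simp_all
  also have "\<dots> = ennreal (r\<^sup>2) * (\<integral>\<^sup>+t. ennreal (V * r ^ (2 * CARD('n)))
       * ennreal (indicator {-1..1} t * sqrt (1 - t\<^sup>2) ^ CARD('n)) \<partial>lborel)"
  proof (rule arg_cong2[where f = "(*)", OF refl], rule nn_integral_cong)
    fix t :: real
    have "r ^ 4 - (r\<^sup>2 * t)\<^sup>2 = (r\<^sup>2)\<^sup>2 * (1 - t\<^sup>2)"
      by (simp add: power_mult_distrib right_diff_distrib)
    then have root: "sqrt (r ^ 4 - (0 + r\<^sup>2 * t)\<^sup>2) ^ CARD('n) = r ^ (2 * CARD('n)) * sqrt (1 - t\<^sup>2) ^ CARD('n)"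
      by (simp only: add_0 real_sqrt_mult real_sqrt_abs abs_power2 power_mult_distrib power_mult)
    have "r\<^sup>2 * t \<le> r\<^sup>2 * 1 \<longleftrightarrow> t \<le> 1" "r\<^sup>2 * (- 1) \<le> r\<^sup>2 * t \<longleftrightarrow> - 1 \<le> t"
      using r by (simp_all only: mult_le_cancel_left_pos zero_less_power)
    then have mem: "0 + r\<^sup>2 * t \<in> {- r\<^sup>2..r\<^sup>2} \<longleftrightarrow> t \<in> {-1..1}"
      by simp
    show "indicator {- r\<^sup>2..r\<^sup>2} (0 + r\<^sup>2 * t) * ennreal (V * sqrt (r ^ 4 - (0 + r\<^sup>2 * t)\<^sup>2) ^ CARD('n))
      = ennreal (V * r ^ (2 * CARD('n))) * ennreal (indicator {-1..1} t * sqrt (1 - t\<^sup>2) ^ CARD('n))"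
    proof (cases "t \<in> {-1..1}")
      case True
      then have "t\<^sup>2 \<le> 1"
        by (simp add: abs_square_le_1 abs_le_iff)
      then show ?thesis
        using True V r unfolding root mem indicator_def
        by (simp add: mult.assoc flip: ennreal_mult)
    next
      case False
      then show ?thesis
        unfolding mem indicator_def by (simp only: if_False of_bool_eq mult_zero_left mult_zero_right ennreal_0)
    qed
  qed
  also have "\<dots> = ennreal (r\<^sup>2) * (ennreal (V * r ^ (2 * CARD('n))) * ennreal (Beta (1 / 2) (real CARD('n) / 2 + 1)))"
    by (subst nn_integral_cmult) (simp_all add: emeasure_cball_aux_integral)
  also have "\<dots> = ennreal (heis_ball_vol TYPE('n) * r ^ (2 * CARD('n) + 2))"
  proof -
    have "ennreal (r\<^sup>2) * (ennreal (V * r ^ (2 * CARD('n))) * ennreal B) = ennreal (V * B * r ^ (2 * CARD('n) + 2))"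
      if "B \<ge> 0" for B
    proof -
      have "ennreal (r\<^sup>2) * (ennreal (V * r ^ (2 * CARD('n))) * ennreal B)
          = ennreal (r\<^sup>2 * (V * r ^ (2 * CARD('n)) * B))"
        using V r that by (simp add: ennreal_mult)
      also have "r\<^sup>2 * (V * r ^ (2 * CARD('n)) * B) = V * B * r ^ (2 * CARD('n) + 2)"
        unfolding power_add by (simp only: mult_ac)
      finally show ?thesis .
    qed
    from this[of "Beta (1 / 2) (real CARD('n) / 2 + 1)"] show ?thesis
      by (simp add: heis_ball_vol_def V_def Beta_def Gamma_real_nonneg)
  qed
  finally show ?thesis by (simp add: X_def)
qed

lemma heis_ball_vol_pos: "heis_ball_vol TYPE('n::finite) > 0"
  by (simp add: heis_ball_vol_def Beta_def Gamma_real_pos)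

lemma heis_ball_vol_eq:
  assumes "Q = heis_dim TYPE('n::finite)"
  shows "heis_ball_vol TYPE('n) = 2 * pi powr ((Q - 2) / 2) * Gamma (1 / 2) * Gamma ((Q + 2) / 4)
             / ((Q - 2) * Gamma ((Q - 2) / 2) * Gamma ((Q + 4) / 4))"
proof -
  define n where "n = real CARD('n)"
  have n: "n > 0" by (simp add: n_def)
  have Q: "Q = 2 * n + 2"
    using assms by (simp add: heis_dim_def n_def)
  have "Gamma (n + 1) = n * Gamma n"
    using n by (intro Gamma_plus1) (auto elim!: nonpos_Ints_cases)
  moreover have Q_shift: "(Q + 4) / 4 = 1 / 2 + (n / 2 + 1)" "(Q + 2) / 4 = n / 2 + 1" "(Q - 2) / 2 = n" "Q - 2 = 2 * n"
    by (simp_all add: Q field_simps)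
  moreover have "Gamma n \<noteq> 0"
    using Gamma_real_pos[OF n] by simp
  ultimately show ?thesis
    using n unfolding Q_shift by (simp add: heis_ball_vol_def unit_ball_vol_def Beta_def mult_ac flip: n_def)
qed

lemma measure_heis_unit_ball:
  "measure lebesgue (heis_unit_ball :: 'n::finite heis set) = heis_ball_vol TYPE('n)"
proof -
  have "heis_unit_ball = {v :: 'n heis. heis_dist 0 v < 1}"
    by (simp add: heis_unit_ball_def heis_dist_def heis_mult_zero heis_norm_def heis_inv_def)
  moreover have "measure lebesgue {v :: 'n heis. heis_dist 0 v < 1} = heis_ball_vol TYPE('n)"
    using emeasure_heis_ball[of 1 "0 :: 'n heis"] heis_ball_vol_pos[where 'n='n] heis_ball_borel[of "0 :: 'n heis" 1]
    by (simp add: measure_def)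
  ultimately show ?thesis by simp
qed

section \<open>The sharp constant\<close>

text \<open>
  The indicator of a compact set of positive measure has a positive norm, and its double integral is
  finite because the kernel is bounded on compact sets.  This caps every admissible constant.
\<close>

lemma reversed_HLS_bounded_above:
  assumes "\<alpha> \<ge> heis_dim TYPE('n::finite)"
  shows "bdd_above {C. reversed_HLS TYPE('n) \<alpha> p C}"
proof -
  define l where "l = \<alpha> - heis_dim TYPE('n)"
  define K :: "'n heis set" where "K = cball 0 1"
  define F :: "'n heis \<Rightarrow> real" where "F = indicator K"
  define m where "m = measure lebesgue K"
  have "emeasure lebesgue K = ennreal (unit_ball_vol (real DIM('n heis)) * 1 ^ DIM('n heis))"
    by (simp add: K_def emeasure_cball)
  moreover have "unit_ball_vol (real DIM('n heis)) > 0"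
    by (rule unit_ball_vol_pos) simp
  ultimately have m: "emeasure lebesgue K = ennreal m" "m > 0"
    by (simp_all add: m_def measure_def)
  have [measurable]: "K \<in> sets lebesgue"
    by (simp add: K_def)
  have "compact ((\<lambda>x. heis_dist (fst x) (snd x)) ` (K \<times> K))"
    by (intro compact_continuous_image continuous_on_heis_dist compact_Times) (simp_all add: K_def)
  then obtain D where D: "heis_dist u v \<le> D" if "u \<in> K" "v \<in> K" for u v
    by (force dest!: compact_imp_bounded bounded_imp_bdd_above simp: bdd_above_def)
  have d0: "heis_dist u v \<ge> 0" for u v :: "'n heis"
    by (simp add: heis_dist_def heis_norm_nonneg)
  have F_powr: "(\<lambda>u. \<bar>F u\<bar> powr p) = indicator K"
    by (auto simp: F_def indicator_def)
  have FL: "F \<in> Lp_space p"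
    unfolding Lp_space_def mem_Collect_eq F_powr using m(1)
    by (auto simp: F_def integrable_indicator_iff)
  define L where "L = Lp_norm p F"
  have L: "L > 0"
    using m(2) by (simp add: L_def Lp_norm_def F_powr m_def[symmetric])
  have "HLS_integral \<alpha> F F \<le> (\<integral>\<^sup>+v. \<integral>\<^sup>+u. ennreal (D powr l) * (indicator K u * indicator K v) \<partial>lebesgue \<partial>lebesgue)"
    unfolding HLS_integral_def
  proof (intro nn_integral_mono)
    fix u v :: "'n heis"
    have "1 / heis_dist u v powr (heis_dim TYPE('n) - \<alpha>) = heis_dist u v powr l"
      by (simp add: l_def flip: powr_minus_divide)
    moreover have "heis_dist u v powr l \<le> D powr l" if "u \<in> K" "v \<in> K"
      using D[OF that] d0 assms by (intro powr_mono2) (auto simp: l_def)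
    ultimately show "ennreal (F u * F v / heis_dist u v powr (heis_dim TYPE('n) - \<alpha>)) \<le>
      ennreal (D powr l) * (indicator K u * indicator K v)"
      by (auto simp: F_def indicator_def intro!: ennreal_leI)
  qed
  also have "\<dots> = ennreal (D powr l * (m * m))"
    using m by (simp add: nn_integral_cmult nn_integral_multc ennreal_mult)
  finally have I: "HLS_integral \<alpha> F F \<le> ennreal (D powr l * (m * m))" .
  have "C \<le> D powr l * (m * m) / (L * L)" if "reversed_HLS TYPE('n) \<alpha> p C" for C
  proof -
    have "ennreal (C * L * L) \<le> HLS_integral \<alpha> F F"
      using that FL by (simp add: reversed_HLS_def L_def F_def)
    from order.trans[OF this I] have "C * L * L \<le> D powr l * (m * m)"
      using m(2) by (subst (asm) ennreal_le_iff) auto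
    then show ?thesis
      using L by (simp add: field_simps)
  qed
  then show ?thesis
    by (auto simp: bdd_above_def)
qed

text \<open>
  For fixed \<open>F\<close> and \<open>G\<close> the inequality bounds the constant by a ratio of numbers, which passes to the
  supremum; there is nothing to show when the double integral is infinite or a norm vanishes.
\<close>

lemma reversed_HLS_Sup:
  assumes "reversed_HLS TYPE('n::finite) \<alpha> p C0"
  shows "reversed_HLS TYPE('n) \<alpha> p (Sup {C. reversed_HLS TYPE('n) \<alpha> p C})"
proof -
  let ?S = "{C. reversed_HLS TYPE('n) \<alpha> p C}"
  have "ennreal (Sup ?S * Lp_norm p F * Lp_norm p G) \<le> HLS_integral \<alpha> F G"
    if FG: "F \<in> Lp_space p" "G \<in> Lp_space p" "\<forall>u. 0 \<le> F u" "\<forall>v. 0 \<le> G v" for F G :: "'n heis \<Rightarrow> real"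
  proof -
    define x where "x = Lp_norm p F * Lp_norm p G"
    have C: "ennreal (C * x) \<le> HLS_integral \<alpha> F G" if "C \<in> ?S" for C
      using that FG by (auto simp: reversed_HLS_def x_def mult.assoc)
    have "x \<ge> 0"
      by (simp add: x_def Lp_norm_def)
    have "ennreal (Sup ?S * x) \<le> HLS_integral \<alpha> F G"
    proof (cases "HLS_integral \<alpha> F G = top \<or> x = 0")
      case False
      then obtain h where h: "h \<ge> 0" "HLS_integral \<alpha> F G = ennreal h"
        by (cases "HLS_integral \<alpha> F G") auto
      have x: "x > 0" using False \<open>x \<ge> 0\<close> by simp
      have "Sup ?S \<le> h / x"
      proof (rule cSup_least)
        show "?S \<noteq> {}" using assms by auto
        show "C \<le> h / x" if "C \<in> ?S" for C
          using C[OF that] h x by (simp add: field_simps)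
      qed
      then show ?thesis
        using x h by (auto simp: field_simps intro!: ennreal_leI)
    qed auto
    then show ?thesis
      by (simp add: x_def mult.assoc)
  qed
  then show ?thesis
    unfolding reversed_HLS_def[of _ _ _ "Sup _"] by blast
qed

lemma heis_upper_regular:
  assumes "l > 0"
  shows "upper_regular_distance lebesgue (heis_dist :: 'n::finite heis \<Rightarrow> _)
           (heis_ball_vol TYPE('n)) (heis_dim TYPE('n)) l"
proof -
  have "emeasure lebesgue {v \<in> space lebesgue. heis_dist u v < r}
      \<le> ennreal (heis_ball_vol TYPE('n) * r powr heis_dim TYPE('n))" if "r > 0" for u :: "'n heis" and r
  proof -
    have "heis_dim TYPE('n) = real (2 * CARD('n) + 2)"
      by (simp add: heis_dim_def)
    then have "r powr heis_dim TYPE('n) = r ^ (2 * CARD('n) + 2)"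
      using that by (simp only: powr_realpow)
    then show ?thesis
      using emeasure_heis_ball[OF that, of u] heis_ball_borel[of u r] by simp
  qed
  then show ?thesis
    using assms
    by (intro upper_regular_distance.intro sigma_finite_lebesgue upper_regular_distance_axioms.intro
          borel_measurable_heis_dist heis_dist_commute heis_ball_vol_pos)
       (simp_all add: heis_dim_def)
qed

lemma reversed_HLS_heis:
  assumes "\<alpha> > Q" and Q: "Q = heis_dim TYPE('n::finite)" and p: "p = 2 * Q / (Q + \<alpha>)"
  shows "reversed_HLS TYPE('n) \<alpha> p ((8 * heis_ball_vol TYPE('n)) powr ((Q - \<alpha>) / Q) / (2 * p\<^sup>2))"
proof -
  interpret H: upper_regular_distance lebesgue "heis_dist :: 'n heis \<Rightarrow> _" "heis_ball_vol TYPE('n)" Q "\<alpha> - Q"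
    unfolding Q using assms by (intro heis_upper_regular) simp
  have "H.p = p" "H.W = (8 * heis_ball_vol TYPE('n)) powr ((Q - \<alpha>) / Q)"
    by (simp_all add: H.p_def H.W_def p)
  moreover have "x / y powr (Q - \<alpha>) = x * y powr (\<alpha> - Q)" for x y :: real
    using powr_minus_divide[of y "Q - \<alpha>"] by simp
  ultimately have "ennreal ((8 * heis_ball_vol TYPE('n)) powr ((Q - \<alpha>) / Q) / (2 * p\<^sup>2) * Lp_norm p F * Lp_norm p G)
      \<le> HLS_integral \<alpha> F G"
    if "F \<in> Lp_space p" "G \<in> Lp_space p" "\<forall>u. 0 \<le> F u" "\<forall>v. 0 \<le> G v" for F G :: "'n heis \<Rightarrow> real"
    using that H.reversed_HLS_bound[of F G]
    by (simp add: HLS_integral_def Lp_space_def Lp_norm_def del: split_paired_All flip: Q)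
  then show ?thesis
    by (simp only: reversed_HLS_def) blast
qed

theorem proposition1p1:
  fixes Q \<alpha> p :: real
  assumes "Q = heis_dim TYPE('n::finite)"
    and "\<alpha> > Q"
    and "p = 2 * Q / (Q + \<alpha>)"
  shows "(\<exists>N. reversed_HLS TYPE('n) \<alpha> p N
            \<and> (\<forall>C. reversed_HLS TYPE('n) \<alpha> p C \<longrightarrow> C \<le> N)
            \<and> N \<ge> (8 * measure lebesgue (heis_unit_ball :: 'n heis set)) powr ((Q - \<alpha>) / Q)
                    / (2 * p\<^sup>2))
       \<and> measure lebesgue (heis_unit_ball :: 'n heis set)
           = 2 * pi powr ((Q - 2) / 2) * Gamma (1 / 2) * Gamma ((Q + 2) / 4)
             / ((Q - 2) * Gamma ((Q - 2) / 2) * Gamma ((Q + 4) / 4))"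
proof -
  have bdd: "bdd_above {C. reversed_HLS TYPE('n) \<alpha> p C}"
    using assms(1,2) by (intro reversed_HLS_bounded_above) auto
  note bound = reversed_HLS_heis[OF assms(2,1,3)]
  have "reversed_HLS TYPE('n) \<alpha> p (Sup {C. reversed_HLS TYPE('n) \<alpha> p C})"
    using bound by (rule reversed_HLS_Sup)
  moreover have "C \<le> Sup {C. reversed_HLS TYPE('n) \<alpha> p C}" if "reversed_HLS TYPE('n) \<alpha> p C" for C
    using that bdd by (intro cSup_upper) auto
  ultimately show ?thesis
    using bound heis_ball_vol_eq[OF assms(1)] unfolding measure_heis_unit_ball by blast
qed

end
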